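(* Let $\mathcal{C}=(\mathcal{C},(-)^\vee,j)$ be a category with duality. Let $F,G:\mathcal{C}\to\mathcal{C}$ be functors and let $(F,G,\eta,\varepsilon)$ be an adjunction from $\mathcal{C}$ to $\mathcal{C}$ ($F$ left adjoint to $G$, with unit $\eta:\mathrm{id}_{\mathcal{C}}\to GF$ and counit $\varepsilon:FG\to\mathrm{id}_{\mathcal{C}}$), and let $\xi_X:F(X^\vee)\to G(X)^\vee$ $(X\in\mathcal{C})$ be a natural transformation. Define the natural transformation $$\zeta_X = F(j_X)^\vee\circ \xi_{X^\vee}^\vee\circ j_{G(X^\vee)}:\ G(X^\vee)\to G(X^\vee)^{\vee\vee}\to F(X^{\vee\vee})^\vee\to F(X)^\vee ,$$ define a contravariant functor by $X^\sharp=G(X^\vee)$, and define $\omega:\mathrm{id}_{\mathcal{C}}\to(-)^{\sharp\sharp}$ by $$\omega_X = G(\xi_{X^\vee})\circ GF(j_X)\circ\eta_X:\ X\to GF(X)\to GF(X^{\vee\vee})\to G(G(X^\vee)^\vee)=X^{\sharp\sharp}.$$ The triple $(\mathcal{C},(-)^\sharp,\omega)$ is a category with duality if $$\eta_X^\vee\circ\xi_{F(X)}\circ F(\zeta_X)=\varepsilon_{X^\vee}:\ FG(X^\vee)\to X^\vee$$ holds for all $X\in\mathcal{C}$. If, moreover, $\mathcal{C}$ is strong, then the following are equivalent: (1) $F$ is an equivalence. (2) $G$ is an equivalence. (3) $(\mathcal{C},(-)^\sharp,\omega)$ is strong.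
   Context: A category with duality is a triple $(\mathcal{C},(-)^\vee,j)$ consisting of a category $\mathcal{C}$, a contravariant functor $(-)^\vee:\mathcal{C}\to\mathcal{C}$ and a natural transformation $j:\mathrm{id}_{\mathcal{C}}\to(-)^{\vee\vee}$ such that $(j_X)^\vee\circ j_{X^\vee}=\mathrm{id}_{X^\vee}$ for all $X\in\mathcal{C}$. It is called strong if $j$ is a natural isomorphism. *)

theory Defs
  imports Main
begin

record ('o, 'a) cat =
  Ob :: "'o set"
  Arr :: "'a set"
  Dom :: "'a \<Rightarrow> 'o"
  Cod :: "'a \<Rightarrow> 'o"
  Ident :: "'o \<Rightarrow> 'a"
  Comp :: "'a \<Rightarrow> 'a \<Rightarrow> 'a"  (infixr "\<cdot>\<index>" 70)

definition hom :: "('o, 'a) cat \<Rightarrow> 'o \<Rightarrow> 'o \<Rightarrow> 'a set" where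
  "hom C X Y = {f \<in> Arr C. Dom C f = X \<and> Cod C f = Y}"

locale category =
  fixes C :: "('o, 'a) cat"  (structure)
  assumes Dom_in_Ob: "f \<in> Arr C \<Longrightarrow> Dom C f \<in> Ob C"
    and Cod_in_Ob: "f \<in> Arr C \<Longrightarrow> Cod C f \<in> Ob C"
    and Ident_in_hom: "X \<in> Ob C \<Longrightarrow> Ident C X \<in> hom C X X"
    and Comp_in_hom: "\<lbrakk>f \<in> hom C X Y; g \<in> hom C Y Z\<rbrakk> \<Longrightarrow> g \<cdot> f \<in> hom C X Z"
    and Comp_Ident: "f \<in> hom C X Y \<Longrightarrow> f \<cdot> Ident C X = f"
    and Ident_Comp: "f \<in> hom C X Y \<Longrightarrow> Ident C Y \<cdot> f = f"
    and Comp_assoc: "\<lbrakk>f \<in> hom C W X; g \<in> hom C X Y; h \<in> hom C Y Z\<rbrakk>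
                      \<Longrightarrow> (h \<cdot> g) \<cdot> f = h \<cdot> (g \<cdot> f)"

definition iso_arr :: "('o, 'a) cat \<Rightarrow> 'a \<Rightarrow> bool" where
  "iso_arr C f \<longleftrightarrow> f \<in> Arr C \<and>
     (\<exists>g \<in> hom C (Cod C f) (Dom C f).
        g \<cdot>\<^bsub>C\<^esub> f = Ident C (Dom C f) \<and> f \<cdot>\<^bsub>C\<^esub> g = Ident C (Cod C f))"

definition opp :: "('o, 'a) cat \<Rightarrow> ('o, 'a) cat" where
  "opp C = \<lparr>Ob = Ob C, Arr = Arr C, Dom = Cod C, Cod = Dom C,
            Ident = Ident C, Comp = (\<lambda>g f. f \<cdot>\<^bsub>C\<^esub> g)\<rparr>"

text \<open>
  The record below holds only the two maps of a functor; source and target category are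
  parameters of the predicate \<open>cat_functor\<close>. Hence the same data \<open>F\<close> serves as
  a functor from \<open>C\<close> to \<open>D\<close> and as one from \<open>opp C\<close> to \<open>opp D\<close>. A contravariant
  functor from \<open>C\<close> to \<open>D\<close> is a functor from \<open>opp C\<close> to \<open>D\<close>.
\<close>

record ('o1, 'a1, 'o2, 'a2) fun_data =
  on_ob :: "'o1 \<Rightarrow> 'o2"
  on_arr :: "'a1 \<Rightarrow> 'a2"

locale cat_functor = source: category C + target: category D
  for C :: "('o1, 'a1) cat" and D :: "('o2, 'a2) cat" +
  fixes F :: "('o1, 'a1, 'o2, 'a2) fun_data"
  assumes on_ob_in: "X \<in> Ob C \<Longrightarrow> on_ob F X \<in> Ob D"
    and on_arr_in: "f \<in> hom C X Y \<Longrightarrow> on_arr F f \<in> hom D (on_ob F X) (on_ob F Y)"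
    and on_arr_Ident: "X \<in> Ob C \<Longrightarrow> on_arr F (Ident C X) = Ident D (on_ob F X)"
    and on_arr_Comp: "\<lbrakk>f \<in> hom C X Y; g \<in> hom C Y Z\<rbrakk>
                       \<Longrightarrow> on_arr F (g \<cdot>\<^bsub>C\<^esub> f) = on_arr F g \<cdot>\<^bsub>D\<^esub> on_arr F f"

definition id_fun :: "('o, 'a, 'o, 'a) fun_data" where
  "id_fun = \<lparr>on_ob = (\<lambda>X. X), on_arr = (\<lambda>f. f)\<rparr>"

definition comp_fun ::
  "('o2, 'a2, 'o3, 'a3) fun_data \<Rightarrow> ('o1, 'a1, 'o2, 'a2) fun_data \<Rightarrow> ('o1, 'a1, 'o3, 'a3) fun_data"
  (infixr "\<circ>\<^sub>F" 55) where
  "G \<circ>\<^sub>F F = \<lparr>on_ob = (\<lambda>X. on_ob G (on_ob F X)), on_arr = (\<lambda>f. on_arr G (on_arr F f))\<rparr>"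

locale natural_transformation = F: cat_functor C D F + G: cat_functor C D G
  for C :: "('o1, 'a1) cat" and D :: "('o2, 'a2) cat"
    and F G :: "('o1, 'a1, 'o2, 'a2) fun_data" +
  fixes \<tau> :: "'o1 \<Rightarrow> 'a2"
  assumes component_in: "X \<in> Ob C \<Longrightarrow> \<tau> X \<in> hom D (on_ob F X) (on_ob G X)"
    and naturality: "f \<in> hom C X Y
                      \<Longrightarrow> \<tau> Y \<cdot>\<^bsub>D\<^esub> on_arr F f = on_arr G f \<cdot>\<^bsub>D\<^esub> \<tau> X"

locale natural_isomorphism = natural_transformation +
  assumes component_iso: "X \<in> Ob C \<Longrightarrow> iso_arr D (\<tau> X)"

locale adjunction =
  F: cat_functor C D F + G: cat_functor D C G +
  unit: natural_transformation C C id_fun "G \<circ>\<^sub>F F" \<eta> +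
  counit: natural_transformation D D "F \<circ>\<^sub>F G" id_fun \<epsilon>
  for C :: "('o1, 'a1) cat" and D :: "('o2, 'a2) cat"
    and F :: "('o1, 'a1, 'o2, 'a2) fun_data" and G :: "('o2, 'a2, 'o1, 'a1) fun_data"
    and \<eta> :: "'o1 \<Rightarrow> 'a1" and \<epsilon> :: "'o2 \<Rightarrow> 'a2" +
  assumes triangle_left:
      "X \<in> Ob C \<Longrightarrow> \<epsilon> (on_ob F X) \<cdot>\<^bsub>D\<^esub> on_arr F (\<eta> X) = Ident D (on_ob F X)"
    and triangle_right:
      "Y \<in> Ob D \<Longrightarrow> on_arr G (\<epsilon> Y) \<cdot>\<^bsub>C\<^esub> \<eta> (on_ob G Y) = Ident C (on_ob G Y)"

definition equivalence ::
  "('o1, 'a1) cat \<Rightarrow> ('o2, 'a2) cat \<Rightarrow> ('o1, 'a1, 'o2, 'a2) fun_data \<Rightarrow> bool" where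
  "equivalence C D F \<longleftrightarrow> cat_functor C D F \<and>
     (\<exists>H \<alpha> \<beta>. cat_functor D C H \<and>
        natural_isomorphism C C id_fun (H \<circ>\<^sub>F F) \<alpha> \<and>
        natural_isomorphism D D (F \<circ>\<^sub>F H) id_fun \<beta>)"

locale category_with_duality =
  category C +
  dual: cat_functor "opp C" C V +
  double_dual: natural_transformation C C id_fun "V \<circ>\<^sub>F V" j
  for C :: "('o, 'a) cat" and V :: "('o, 'a, 'o, 'a) fun_data" and j :: "'o \<Rightarrow> 'a" +
  assumes duality_triangle:
    "X \<in> Ob C \<Longrightarrow> on_arr V (j X) \<cdot>\<^bsub>C\<^esub> j (on_ob V X) = Ident C (on_ob V X)"

locale strong_category_with_duality =
  category_with_duality C V j +
  natural_isomorphism C C id_fun "V \<circ>\<^sub>F V" j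
  for C :: "('o, 'a) cat" and V :: "('o, 'a, 'o, 'a) fun_data" and j :: "'o \<Rightarrow> 'a"

text \<open>
  \<open>F\<close>, \<open>G\<close> and \<open>V\<close> are endofunctor data on \<open>C\<close>, with \<open>V\<close> the duality functor of
  \<open>(C, V, j)\<close>; so \<open>on_ob V X\<close> is the dual object of \<open>X\<close>, and \<open>\<xi> X\<close> is an arrow from
  \<open>F (V X)\<close> to \<open>V (G X)\<close>.
\<close>

definition zeta ::
  "('o, 'a) cat \<Rightarrow> ('o, 'a, 'o, 'a) fun_data \<Rightarrow> ('o \<Rightarrow> 'a) \<Rightarrow> ('o, 'a, 'o, 'a) fun_data \<Rightarrow>
   ('o, 'a, 'o, 'a) fun_data \<Rightarrow> ('o \<Rightarrow> 'a) \<Rightarrow> 'o \<Rightarrow> 'a" where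
  "zeta C V j F G \<xi> X =
     on_arr V (on_arr F (j X)) \<cdot>\<^bsub>C\<^esub> on_arr V (\<xi> (on_ob V X)) \<cdot>\<^bsub>C\<^esub> j (on_ob G (on_ob V X))"

definition sharp ::
  "('o, 'a, 'o, 'a) fun_data \<Rightarrow> ('o, 'a, 'o, 'a) fun_data \<Rightarrow> ('o, 'a, 'o, 'a) fun_data" where
  "sharp V G = G \<circ>\<^sub>F V"

definition omega ::
  "('o, 'a) cat \<Rightarrow> ('o, 'a, 'o, 'a) fun_data \<Rightarrow> ('o \<Rightarrow> 'a) \<Rightarrow> ('o, 'a, 'o, 'a) fun_data \<Rightarrow>
   ('o, 'a, 'o, 'a) fun_data \<Rightarrow> ('o \<Rightarrow> 'a) \<Rightarrow> ('o \<Rightarrow> 'a) \<Rightarrow> 'o \<Rightarrow> 'a" where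
  "omega C V j F G \<eta> \<xi> X =
     on_arr G (\<xi> (on_ob V X)) \<cdot>\<^bsub>C\<^esub> on_arr G (on_arr F (j X)) \<cdot>\<^bsub>C\<^esub> \<eta> X"

end

(*
  Transposing along the adjunction turns the triangle identity of (C, sharp, omega) into
  V(omega_X) o xi_{VB} o F(j_B) = epsilon_{VX} with B = G(VX); moving V(omega_X) past xi by
  naturality makes the left-hand side V(eta_X) o xi_{FX} o F(zeta_X), so this is the hypothesis.

  A category with duality is an adjunction between C and its opposite in which both functors
  are V and unit and counit are j. The unit of an adjunction is invertible as soon as one of the
  two functors is an equivalence, hence the duality is strong iff V is an equivalence. If V is
  one, then sharp = G o V is an equivalence iff G is, by two-out-of-three.
*)
theory Submission
  imports Defs
begin

section \<open>Categories and opposites\<close>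

lemma opp_simps [simp]:
  "Ob (opp C) = Ob C" "Arr (opp C) = Arr C" "Dom (opp C) = Cod C" "Cod (opp C) = Dom C"
  "Ident (opp C) = Ident C" "g \<cdot>\<^bsub>opp C\<^esub> f = f \<cdot>\<^bsub>C\<^esub> g"
  by (simp_all add: opp_def)

lemma opp_opp [simp]: "opp (opp C) = C"
  by (simp add: opp_def)

lemma hom_opp [simp]: "hom (opp C) X Y = hom C Y X"
  by (auto simp: hom_def)

lemma iso_arr_opp [simp]: "iso_arr (opp C) f \<longleftrightarrow> iso_arr C f"
  by (auto simp: iso_arr_def)

lemma comp_fun_simps [simp]:
  "on_ob (G \<circ>\<^sub>F F) X = on_ob G (on_ob F X)" "on_arr (G \<circ>\<^sub>F F) f = on_arr G (on_arr F f)"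
  by (simp_all add: comp_fun_def)

lemma id_fun_simps [simp]: "on_ob id_fun X = X" "on_arr id_fun f = f"
  by (simp_all add: id_fun_def)

lemma comp_fun_assoc [simp]: "(H \<circ>\<^sub>F G) \<circ>\<^sub>F F = H \<circ>\<^sub>F G \<circ>\<^sub>F F"
  by (simp add: comp_fun_def)

lemma comp_fun_id [simp]: "F \<circ>\<^sub>F id_fun = F" "id_fun \<circ>\<^sub>F F = F"
  by (simp_all add: comp_fun_def id_fun_def)

lemma category_opp: "category C \<Longrightarrow> category (opp C)"
  unfolding category_def by (auto simp: hom_def)

section \<open>Isomorphisms and cancellation in a category\<close>

context category
begin

lemma hom_Ob: "f \<in> hom C X Y \<Longrightarrow> X \<in> Ob C \<and> Y \<in> Ob C"
  using Dom_in_Ob Cod_in_Ob by (auto simp: hom_def)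

lemma iso_arrI:
  assumes "f \<in> hom C X Y" "g \<in> hom C Y X" "g \<cdot> f = Ident C X" "f \<cdot> g = Ident C Y"
  shows "iso_arr C f"
  using assms by (auto simp: iso_arr_def hom_def)

lemma iso_arrE:
  assumes "iso_arr C f" "f \<in> hom C X Y"
  obtains g where "g \<in> hom C Y X" "g \<cdot> f = Ident C X" "f \<cdot> g = Ident C Y" "iso_arr C g"
proof -
  from assms obtain g where g: "g \<in> hom C Y X" "g \<cdot> f = Ident C X" "f \<cdot> g = Ident C Y"
    by (auto simp: iso_arr_def hom_def)
  with assms(2) show thesis by (intro that[of g] iso_arrI[of g Y X f]) auto
qed

text \<open>Cancellation of \<open>g \<cdot> f\<close> inside a longer composite. This rule and its
  mirror image ask for a one-sided inverse, so they also apply to the triangle identities of an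
  adjunction, where the arrows need not be invertible.\<close>

lemma Comp_left_inverse:
  assumes "f \<in> hom C X Y" "g \<in> hom C Y X" "g \<cdot> f = Ident C X" "h \<in> hom C W X"
  shows "g \<cdot> f \<cdot> h = h"
  using Comp_assoc[OF assms(4,1,2)] assms(3) Ident_Comp[OF assms(4)] by simp

lemma Comp_right_inverse:
  assumes "f \<in> hom C X Y" "g \<in> hom C Y X" "g \<cdot> f = Ident C X" "h \<in> hom C X Z"
  shows "(h \<cdot> g) \<cdot> f = h"
  using Comp_assoc[OF assms(1,2,4)] assms(3) Comp_Ident[OF assms(4)] by simp

lemma iso_left_cancel:
  assumes "iso_arr C u" "u \<in> hom C Y Z" "f \<in> hom C X Y" "g \<in> hom C X Y" "u \<cdot> f = u \<cdot> g"
  shows "f = g"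
proof -
  obtain v where v: "v \<in> hom C Z Y" "v \<cdot> u = Ident C Y"
    using assms(1,2) by (metis iso_arrE)
  show ?thesis
    using Comp_left_inverse[OF assms(2) v assms(3)] Comp_left_inverse[OF assms(2) v assms(4)]
      assms(5) by metis
qed

lemma iso_right_cancel:
  assumes "iso_arr C u" "u \<in> hom C X Y" "f \<in> hom C Y Z" "g \<in> hom C Y Z" "f \<cdot> u = g \<cdot> u"
  shows "f = g"
proof -
  obtain v where v: "v \<in> hom C Y X" "u \<cdot> v = Ident C Y"
    using assms(1,2) by (metis iso_arrE)
  show ?thesis
    using Comp_right_inverse[OF v(1) assms(2) v(2) assms(3)]
      Comp_right_inverse[OF v(1) assms(2) v(2) assms(4)] assms(5) by metis
qed

lemma iso_arr_Comp:
  assumes f: "iso_arr C f" "f \<in> hom C X Y" and g: "iso_arr C g" "g \<in> hom C Y Z"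
  shows "iso_arr C (g \<cdot> f)"
proof -
  obtain f' where f': "f' \<in> hom C Y X" "f' \<cdot> f = Ident C X" "f \<cdot> f' = Ident C Y"
    using f by (metis iso_arrE)
  obtain g' where g': "g' \<in> hom C Z Y" "g' \<cdot> g = Ident C Y" "g \<cdot> g' = Ident C Z"
    using g by (metis iso_arrE)
  show ?thesis
  proof (rule iso_arrI)
    show gf: "g \<cdot> f \<in> hom C X Z" and fg': "f' \<cdot> g' \<in> hom C Z X"
      using f g f' g' by (auto intro: Comp_in_hom)
    show "(f' \<cdot> g') \<cdot> g \<cdot> f = Ident C X"
      using Comp_assoc[OF gf g'(1) f'(1)] Comp_left_inverse[OF g(2) g'(1,2) f(2)] f'(2) by simp
    show "(g \<cdot> f) \<cdot> f' \<cdot> g' = Ident C Z"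
      using Comp_assoc[OF fg' f(2) g(2)] Comp_left_inverse[OF f'(1) f(2) f'(3) g'(1)] g'(3) by simp
  qed
qed

text \<open>With an inverse \<open>g'\<close> of \<open>g\<close>, the arrow \<open>f\<close> equals
  \<open>g' \<cdot> (g \<cdot> f)\<close>, a composite of two isomorphisms.\<close>

lemma iso_arr_right_factor:
  assumes g: "iso_arr C g" "g \<in> hom C Y Z" and f: "f \<in> hom C X Y" and gf: "iso_arr C (g \<cdot> f)"
  shows "iso_arr C f"
proof -
  obtain g' where g': "g' \<in> hom C Z Y" "g' \<cdot> g = Ident C Y" "iso_arr C g'"
    using g by (metis iso_arrE)
  have "iso_arr C (g' \<cdot> g \<cdot> f)"
    by (rule iso_arr_Comp[OF gf Comp_in_hom[OF f g(2)] g'(3,1)])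
  then show ?thesis
    by (simp add: Comp_left_inverse[OF g(2) g'(1,2) f])
qed

end

section \<open>Functors and natural transformations\<close>

lemma (in cat_functor) opposite: "cat_functor (opp C) (opp D) F"
  by (intro cat_functor.intro category_opp source.category_axioms target.category_axioms
      cat_functor_axioms.intro)
    (auto simp: on_ob_in on_arr_in on_arr_Ident on_arr_Comp)

lemma (in cat_functor) iso_on_arr:
  assumes "iso_arr C f" "f \<in> hom C X Y"
  shows "iso_arr D (on_arr F f)"
proof -
  obtain g where g: "g \<in> hom C Y X" "g \<cdot>\<^bsub>C\<^esub> f = Ident C X" "f \<cdot>\<^bsub>C\<^esub> g = Ident C Y"
    using assms by (rule source.iso_arrE) blast
  have Ob: "X \<in> Ob C" "Y \<in> Ob C" using source.hom_Ob[OF assms(2)] by auto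
  show ?thesis
    by (rule target.iso_arrI[OF on_arr_in[OF assms(2)] on_arr_in[OF g(1)]])
      (simp_all add: on_arr_Comp[OF assms(2) g(1), symmetric] on_arr_Comp[OF g(1) assms(2), symmetric]
        g on_arr_Ident Ob)
qed

lemma cat_functor_comp:
  assumes "cat_functor B C F" "cat_functor C D G"
  shows "cat_functor B D (G \<circ>\<^sub>F F)"
proof -
  interpret F: cat_functor B C F by fact
  interpret G: cat_functor C D G by fact
  show ?thesis
    by unfold_locales
      (auto simp: F.on_ob_in G.on_ob_in F.on_arr_Ident G.on_arr_Ident F.on_arr_Comp
        intro!: G.on_arr_in F.on_arr_in G.on_arr_Comp)
qed

text \<open>The components stay the same, but each of them changes direction, so \<open>F\<close>
  and \<open>G\<close> trade places. This is what exchanges unit and counit of an adjunction and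
  what lets the contravariant \<open>V\<close> be applied to a transformation.\<close>

lemma natural_transformation_opposite:
  assumes "natural_transformation C D F G \<tau>"
  shows "natural_transformation (opp C) (opp D) G F \<tau>"
proof -
  interpret natural_transformation C D F G \<tau> by fact
  show ?thesis
    by (intro natural_transformation.intro F.opposite G.opposite natural_transformation_axioms.intro)
      (auto simp: component_in naturality)
qed

lemma natural_transformation_comp:
  assumes "natural_transformation C D F G \<sigma>" "natural_transformation C D G H \<tau>"
  shows "natural_transformation C D F H (\<lambda>X. \<tau> X \<cdot>\<^bsub>D\<^esub> \<sigma> X)"
proof -
  interpret s: natural_transformation C D F G \<sigma> by fact
  interpret t: natural_transformation C D G H \<tau> by fact
  show ?thesis
  proof unfold_locales
    fix X assume "X \<in> Ob C"
    then show "\<tau> X \<cdot>\<^bsub>D\<^esub> \<sigma> X \<in> hom D (on_ob F X) (on_ob H X)"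
      by (blast intro: s.F.target.Comp_in_hom s.component_in t.component_in)
  next
    fix f X Y assume f: "f \<in> hom C X Y"
    then have Ob: "X \<in> Ob C" "Y \<in> Ob C" using s.F.source.hom_Ob by auto
    note hom = s.component_in[OF Ob(1)] s.component_in[OF Ob(2)] t.component_in[OF Ob(1)]
      t.component_in[OF Ob(2)] s.F.on_arr_in[OF f] s.G.on_arr_in[OF f] t.G.on_arr_in[OF f]
    show "(\<tau> Y \<cdot>\<^bsub>D\<^esub> \<sigma> Y) \<cdot>\<^bsub>D\<^esub> on_arr F f = on_arr H f \<cdot>\<^bsub>D\<^esub> \<tau> X \<cdot>\<^bsub>D\<^esub> \<sigma> X"
      using s.F.target.Comp_assoc[OF hom(5,2,4)] s.F.target.Comp_assoc[OF hom(1,6,4)]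
        s.F.target.Comp_assoc[OF hom(1,3,7)] s.naturality[OF f] t.naturality[OF f] by simp
  qed
qed

text \<open>Whiskering on either side, together with vertical composition, builds \<zeta> and
  \<omega> from \<open>j\<close>, \<xi> and \<eta>, so that their naturality needs no separate
  diagram chase.\<close>

lemma natural_transformation_whisker_left:
  assumes "natural_transformation C D F G \<tau>" "cat_functor D E H"
  shows "natural_transformation C E (H \<circ>\<^sub>F F) (H \<circ>\<^sub>F G) (\<lambda>X. on_arr H (\<tau> X))"
proof -
  interpret natural_transformation C D F G \<tau> by fact
  interpret H: cat_functor D E H by fact
  show ?thesis
  proof (intro natural_transformation.intro cat_functor_comp[OF _ assms(2)] F.cat_functor_axioms
      G.cat_functor_axioms natural_transformation_axioms.intro)
    fix f X Y assume f: "f \<in> hom C X Y"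
    then have Ob: "X \<in> Ob C" "Y \<in> Ob C" using F.source.hom_Ob by auto
    show "on_arr H (\<tau> Y) \<cdot>\<^bsub>E\<^esub> on_arr (H \<circ>\<^sub>F F) f = on_arr (H \<circ>\<^sub>F G) f \<cdot>\<^bsub>E\<^esub> on_arr H (\<tau> X)"
      using H.on_arr_Comp[OF F.on_arr_in[OF f] component_in[OF Ob(2)]]
        H.on_arr_Comp[OF component_in[OF Ob(1)] G.on_arr_in[OF f]] naturality[OF f] by simp
  qed (simp add: H.on_arr_in component_in)
qed

lemma natural_transformation_whisker_right:
  assumes "natural_transformation C D F G \<tau>" "cat_functor B C K"
  shows "natural_transformation B D (F \<circ>\<^sub>F K) (G \<circ>\<^sub>F K) (\<lambda>X. \<tau> (on_ob K X))"
proof -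
  interpret natural_transformation C D F G \<tau> by fact
  interpret K: cat_functor B C K by fact
  show ?thesis
    by (intro natural_transformation.intro cat_functor_comp[OF assms(2)] F.cat_functor_axioms
        G.cat_functor_axioms natural_transformation_axioms.intro)
      (auto simp: component_in K.on_ob_in intro: naturality K.on_arr_in)
qed

text \<open>Pointwise inverses are automatically natural. The definition of
  \<open>equivalence\<close> fixes a direction for both of its isomorphisms, so exchanging the two
  functors requires inverting them.\<close>

lemma natural_isomorphism_inverse:
  assumes "natural_isomorphism C D F G \<tau>"
  obtains \<sigma> where "natural_isomorphism C D G F \<sigma>"
proof -
  interpret natural_isomorphism C D F G \<tau> by fact
  have "\<forall>X \<in> Ob C. \<exists>s. s \<in> hom D (on_ob G X) (on_ob F X) \<and> s \<cdot>\<^bsub>D\<^esub> \<tau> X = Ident D (on_ob F X) \<and>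
      \<tau> X \<cdot>\<^bsub>D\<^esub> s = Ident D (on_ob G X) \<and> iso_arr D s"
    by (metis F.target.iso_arrE component_in component_iso)
  then obtain \<sigma> where \<sigma>: "\<And>X. X \<in> Ob C \<Longrightarrow> \<sigma> X \<in> hom D (on_ob G X) (on_ob F X)"
      "\<And>X. X \<in> Ob C \<Longrightarrow> \<sigma> X \<cdot>\<^bsub>D\<^esub> \<tau> X = Ident D (on_ob F X)"
      "\<And>X. X \<in> Ob C \<Longrightarrow> \<tau> X \<cdot>\<^bsub>D\<^esub> \<sigma> X = Ident D (on_ob G X)"
      "\<And>X. X \<in> Ob C \<Longrightarrow> iso_arr D (\<sigma> X)"
    by metis
  have "natural_isomorphism C D G F \<sigma>"
  proof unfold_locales
    fix f X Y assume f: "f \<in> hom C X Y"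
    then have Ob: "X \<in> Ob C" "Y \<in> Ob C" using F.source.hom_Ob by auto
    note hom = component_in[OF Ob(1)] component_in[OF Ob(2)] \<sigma>(1)[OF Ob(1)] \<sigma>(1)[OF Ob(2)]
      F.on_arr_in[OF f] G.on_arr_in[OF f]
    \<comment> \<open>The identity \<open>\<tau> X \<cdot> \<sigma> X\<close> is inserted on the
      right, so that naturality of \<tau> becomes applicable; afterwards \<sigma> at
      \<open>Y\<close> cancels \<tau> at \<open>Y\<close>.\<close>
    have "\<sigma> Y \<cdot>\<^bsub>D\<^esub> on_arr G f = \<sigma> Y \<cdot>\<^bsub>D\<^esub> (on_arr G f \<cdot>\<^bsub>D\<^esub> \<tau> X) \<cdot>\<^bsub>D\<^esub> \<sigma> X"
      using F.target.Comp_right_inverse[OF hom(3,1) \<sigma>(3)[OF Ob(1)] hom(6)]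
        F.target.Comp_assoc[OF hom(3,1,6)] by simp
    also have "\<dots> = \<sigma> Y \<cdot>\<^bsub>D\<^esub> \<tau> Y \<cdot>\<^bsub>D\<^esub> on_arr F f \<cdot>\<^bsub>D\<^esub> \<sigma> X"
      using naturality[OF f] F.target.Comp_assoc[OF hom(3,5,2)] by simp
    also have "\<dots> = on_arr F f \<cdot>\<^bsub>D\<^esub> \<sigma> X"
      by (rule F.target.Comp_left_inverse[OF hom(2,4) \<sigma>(2)[OF Ob(2)] F.target.Comp_in_hom[OF hom(3,5)]])
    finally show "\<sigma> Y \<cdot>\<^bsub>D\<^esub> on_arr G f = on_arr F f \<cdot>\<^bsub>D\<^esub> \<sigma> X" .
  qed (simp_all add: \<sigma>)
  then show thesis by (rule that)
qed

section \<open>Equivalences\<close>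

text \<open>
  Fully faithful and essentially surjective. Unlike \<open>equivalence\<close>, this is manifestly
  self-opposite and has an elementary two-out-of-three property.
\<close>

definition weak_equivalence ::
  "('o1, 'a1) cat \<Rightarrow> ('o2, 'a2) cat \<Rightarrow> ('o1, 'a1, 'o2, 'a2) fun_data \<Rightarrow> bool" where
  "weak_equivalence C D F \<longleftrightarrow> cat_functor C D F \<and>
     (\<forall>X \<in> Ob C. \<forall>Y \<in> Ob C.
        bij_betw (on_arr F) (hom C X Y) (hom D (on_ob F X) (on_ob F Y))) \<and>
     (\<forall>Z \<in> Ob D. \<exists>X \<in> Ob C. \<exists>u \<in> hom D Z (on_ob F X). iso_arr D u)"

lemma weak_equivalence_ess_surjE:
  assumes "weak_equivalence C D F" "Z \<in> Ob D"
  obtains X u v where "X \<in> Ob C" "u \<in> hom D Z (on_ob F X)" "v \<in> hom D (on_ob F X) Z"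
    "v \<cdot>\<^bsub>D\<^esub> u = Ident D Z" "u \<cdot>\<^bsub>D\<^esub> v = Ident D (on_ob F X)" "iso_arr D u" "iso_arr D v"
proof -
  interpret cat_functor C D F using assms(1) by (simp add: weak_equivalence_def)
  obtain X u where X: "X \<in> Ob C" "u \<in> hom D Z (on_ob F X)" "iso_arr D u"
    using assms by (auto simp: weak_equivalence_def)
  obtain v where "v \<in> hom D (on_ob F X) Z" "v \<cdot>\<^bsub>D\<^esub> u = Ident D Z"
      "u \<cdot>\<^bsub>D\<^esub> v = Ident D (on_ob F X)" "iso_arr D v"
    using X(3,2) by (rule target.iso_arrE) blast
  with X that show thesis by blast
qed

text \<open>Bijectivity on hom-sets is quantified over all pairs of objects, so reversing arrows
  only swaps the pair. For essential surjectivity the isomorphism out of \<open>Z\<close> is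
  replaced by its inverse.\<close>

lemma weak_equivalence_opposite:
  assumes "weak_equivalence C D F"
  shows "weak_equivalence (opp C) (opp D) F"
proof -
  interpret cat_functor C D F using assms by (simp add: weak_equivalence_def)
  show ?thesis
    unfolding weak_equivalence_def
  proof (intro conjI opposite ballI)
    fix Z assume "Z \<in> Ob (opp D)"
    then have "Z \<in> Ob D" by simp
    with assms obtain X v where "X \<in> Ob C" "v \<in> hom D (on_ob F X) Z" "iso_arr D v"
      by (rule weak_equivalence_ess_surjE) blast
    then show "\<exists>X \<in> Ob (opp C). \<exists>u \<in> hom (opp D) Z (on_ob F X). iso_arr (opp D) u"
      by auto
  qed (use assms in \<open>auto simp: weak_equivalence_def\<close>)
qed

section \<open>Composition and cancellation of fully faithful, essentially surjective
  functors\<close>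

lemma weak_equivalence_comp:
  assumes F: "weak_equivalence B C F" and G: "weak_equivalence C D G"
  shows "weak_equivalence B D (G \<circ>\<^sub>F F)"
proof -
  interpret F: cat_functor B C F using F by (simp add: weak_equivalence_def)
  interpret G: cat_functor C D G using G by (simp add: weak_equivalence_def)
  show ?thesis
    unfolding weak_equivalence_def
  proof (intro conjI ballI)
    show "cat_functor B D (G \<circ>\<^sub>F F)"
      by (rule cat_functor_comp[OF F.cat_functor_axioms G.cat_functor_axioms])
  next
    fix X Y assume "X \<in> Ob B" "Y \<in> Ob B"
    then have "bij_betw (on_arr G \<circ> on_arr F) (hom B X Y)
        (hom D (on_ob G (on_ob F X)) (on_ob G (on_ob F Y)))"
      using F G F.on_ob_in by (intro bij_betw_trans) (auto simp: weak_equivalence_def)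
    then show "bij_betw (on_arr (G \<circ>\<^sub>F F)) (hom B X Y) (hom D (on_ob (G \<circ>\<^sub>F F) X) (on_ob (G \<circ>\<^sub>F F) Y))"
      by (simp add: comp_fun_def comp_def)
  next
    fix Z assume "Z \<in> Ob D"
    with G obtain Y w where Y: "Y \<in> Ob C" "w \<in> hom D Z (on_ob G Y)" "iso_arr D w"
      by (rule weak_equivalence_ess_surjE) blast
    from F Y(1) obtain X u where X: "X \<in> Ob B" "u \<in> hom C Y (on_ob F X)" "iso_arr C u"
      by (rule weak_equivalence_ess_surjE) blast
    have "on_arr G u \<cdot>\<^bsub>D\<^esub> w \<in> hom D Z (on_ob G (on_ob F X))"
      by (rule G.target.Comp_in_hom[OF Y(2) G.on_arr_in[OF X(2)]])
    moreover have "iso_arr D (on_arr G u \<cdot>\<^bsub>D\<^esub> w)"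
      by (rule G.target.iso_arr_Comp[OF Y(3,2) G.iso_on_arr[OF X(3,2)] G.on_arr_in[OF X(2)]])
    ultimately show "\<exists>X \<in> Ob B. \<exists>u \<in> hom D Z (on_ob (G \<circ>\<^sub>F F) X). iso_arr D u"
      using X(1) by auto
  qed
qed

text \<open>On objects in the image of \<open>F\<close>, full faithfulness of \<open>G\<close>
  follows from that of \<open>F\<close> and of the composite. Every object of \<open>C\<close> is
  isomorphic to one in that image, and conjugation with such isomorphisms transports the property to
  all hom-sets.\<close>

lemma weak_equivalence_left_factor:
  assumes F: "weak_equivalence B C F" and G: "cat_functor C D G"
    and GF: "weak_equivalence B D (G \<circ>\<^sub>F F)"
  shows "weak_equivalence C D G"
proof -
  interpret F: cat_functor B C F using F by (simp add: weak_equivalence_def)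
  interpret G: cat_functor C D G by fact
  have bij: "bij_betw (on_arr G) (hom C (on_ob F A) (on_ob F B'))
      (hom D (on_ob G (on_ob F A)) (on_ob G (on_ob F B')))"
    if "A \<in> Ob B" "B' \<in> Ob B" for A B'
  proof -
    have "bij_betw (on_arr F) (hom B A B') (hom C (on_ob F A) (on_ob F B'))"
      using F that by (simp add: weak_equivalence_def)
    moreover have "bij_betw (on_arr G \<circ> on_arr F) (hom B A B')
        (hom D (on_ob G (on_ob F A)) (on_ob G (on_ob F B')))"
      using GF that by (simp add: weak_equivalence_def comp_fun_def comp_def)
    ultimately show ?thesis using bij_betw_comp_iff by blast
  qed
  show ?thesis
    unfolding weak_equivalence_def
  proof (intro conjI ballI G)
    fix X Y assume Ob: "X \<in> Ob C" "Y \<in> Ob C"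
    from F Ob(1) obtain A u u' where A: "A \<in> Ob B" and u: "u \<in> hom C X (on_ob F A)"
        "u' \<in> hom C (on_ob F A) X" "u' \<cdot>\<^bsub>C\<^esub> u = Ident C X" "u \<cdot>\<^bsub>C\<^esub> u' = Ident C (on_ob F A)"
        "iso_arr C u" "iso_arr C u'"
      by (rule weak_equivalence_ess_surjE) blast
    from F Ob(2) obtain A' v v' where A': "A' \<in> Ob B" and v: "v \<in> hom C Y (on_ob F A')"
        "v' \<in> hom C (on_ob F A') Y" "v' \<cdot>\<^bsub>C\<^esub> v = Ident C Y" "v \<cdot>\<^bsub>C\<^esub> v' = Ident C (on_ob F A')"
        "iso_arr C v" "iso_arr C v'"
      by (rule weak_equivalence_ess_surjE) blast
    \<comment> \<open>Conjugation moves an arrow from \<open>X\<close> to \<open>Y\<close> to one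
      between objects in the image of \<open>F\<close>, where \<open>bij\<close> applies, and
      \<open>G\<close> respects the conjugation.\<close>
    have conj: "v \<cdot>\<^bsub>C\<^esub> f \<cdot>\<^bsub>C\<^esub> u' \<in> hom C (on_ob F A) (on_ob F A')"
      "on_arr G (v \<cdot>\<^bsub>C\<^esub> f \<cdot>\<^bsub>C\<^esub> u') = on_arr G v \<cdot>\<^bsub>D\<^esub> on_arr G f \<cdot>\<^bsub>D\<^esub> on_arr G u'"
      if "f \<in> hom C X Y" for f
    proof -
      have fu: "f \<cdot>\<^bsub>C\<^esub> u' \<in> hom C (on_ob F A) Y"
        by (rule F.target.Comp_in_hom[OF u(2) that])
      show "v \<cdot>\<^bsub>C\<^esub> f \<cdot>\<^bsub>C\<^esub> u' \<in> hom C (on_ob F A) (on_ob F A')"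
        by (rule F.target.Comp_in_hom[OF fu v(1)])
      show "on_arr G (v \<cdot>\<^bsub>C\<^esub> f \<cdot>\<^bsub>C\<^esub> u') = on_arr G v \<cdot>\<^bsub>D\<^esub> on_arr G f \<cdot>\<^bsub>D\<^esub> on_arr G u'"
        by (simp add: G.on_arr_Comp[OF fu v(1)] G.on_arr_Comp[OF u(2) that])
    qed
    show "bij_betw (on_arr G) (hom C X Y) (hom D (on_ob G X) (on_ob G Y))"
      unfolding bij_betw_def
    proof (intro conjI inj_onI subset_antisym subsetI)
      fix f g assume fg: "f \<in> hom C X Y" "g \<in> hom C X Y" "on_arr G f = on_arr G g"
      have "v \<cdot>\<^bsub>C\<^esub> f \<cdot>\<^bsub>C\<^esub> u' = v \<cdot>\<^bsub>C\<^esub> g \<cdot>\<^bsub>C\<^esub> u'"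
        by (rule inj_onD[OF bij_betw_imp_inj_on[OF bij[OF A A']]])
          (simp_all add: conj fg)
      then have "f \<cdot>\<^bsub>C\<^esub> u' = g \<cdot>\<^bsub>C\<^esub> u'"
        using F.target.iso_left_cancel[OF v(5,1)] F.target.Comp_in_hom[OF u(2)] fg by blast
      then show "f = g"
        using F.target.iso_right_cancel[OF u(6,2)] fg by blast
    next
      fix k assume "k \<in> on_arr G ` hom C X Y"
      then show "k \<in> hom D (on_ob G X) (on_ob G Y)" using G.on_arr_in by auto
    next
      fix k assume k: "k \<in> hom D (on_ob G X) (on_ob G Y)"
      note Gu = G.on_arr_in[OF u(1)] G.on_arr_in[OF u(2)]
      note Gv = G.on_arr_in[OF v(1)] G.on_arr_in[OF v(2)]
      have ku: "k \<cdot>\<^bsub>D\<^esub> on_arr G u' \<in> hom D (on_ob G (on_ob F A)) (on_ob G Y)"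
        by (rule G.target.Comp_in_hom[OF Gu(2) k])
      then have "on_arr G v \<cdot>\<^bsub>D\<^esub> k \<cdot>\<^bsub>D\<^esub> on_arr G u'
          \<in> hom D (on_ob G (on_ob F A)) (on_ob G (on_ob F A'))"
        by (rule G.target.Comp_in_hom[OF _ Gv(1)])
      \<comment> \<open>Fullness on the image of \<open>F\<close> gives a preimage \<open>l\<close>
        of the conjugate of \<open>k\<close>; conjugating \<open>l\<close> back yields the preimage
        \<open>v' \<cdot> l \<cdot> u\<close> of \<open>k\<close> itself.\<close>
      then obtain l where l: "l \<in> hom C (on_ob F A) (on_ob F A')"
          "on_arr G l = on_arr G v \<cdot>\<^bsub>D\<^esub> k \<cdot>\<^bsub>D\<^esub> on_arr G u'"
        using bij_betw_imp_surj_on[OF bij[OF A A']] by (metis imageE)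
      have lu: "l \<cdot>\<^bsub>C\<^esub> u \<in> hom C X (on_ob F A')"
        by (rule F.target.Comp_in_hom[OF u(1) l(1)])
      have f: "v' \<cdot>\<^bsub>C\<^esub> l \<cdot>\<^bsub>C\<^esub> u \<in> hom C X Y"
        by (rule F.target.Comp_in_hom[OF lu v(2)])
      have "v \<cdot>\<^bsub>C\<^esub> (v' \<cdot>\<^bsub>C\<^esub> l \<cdot>\<^bsub>C\<^esub> u) \<cdot>\<^bsub>C\<^esub> u' = l"
        using F.target.Comp_assoc[OF u(2) lu v(2)] F.target.Comp_right_inverse[OF u(2,1,4) l(1)]
          F.target.Comp_left_inverse[OF v(2,1,4) l(1)] by simp
      then have "on_arr G v \<cdot>\<^bsub>D\<^esub> on_arr G (v' \<cdot>\<^bsub>C\<^esub> l \<cdot>\<^bsub>C\<^esub> u) \<cdot>\<^bsub>D\<^esub> on_arr G u'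
          = on_arr G v \<cdot>\<^bsub>D\<^esub> k \<cdot>\<^bsub>D\<^esub> on_arr G u'"
        using conj(2)[OF f] l(2) by simp
      then have "on_arr G (v' \<cdot>\<^bsub>C\<^esub> l \<cdot>\<^bsub>C\<^esub> u) \<cdot>\<^bsub>D\<^esub> on_arr G u' = k \<cdot>\<^bsub>D\<^esub> on_arr G u'"
        using G.target.iso_left_cancel[OF G.iso_on_arr[OF v(5,1)] Gv(1)]
          G.target.Comp_in_hom[OF Gu(2)] G.on_arr_in[OF f] k by blast
      then have "on_arr G (v' \<cdot>\<^bsub>C\<^esub> l \<cdot>\<^bsub>C\<^esub> u) = k"
        using G.target.iso_right_cancel[OF G.iso_on_arr[OF u(6,2)] Gu(2)] G.on_arr_in[OF f] k
        by blast
      with f show "k \<in> on_arr G ` hom C X Y" by blast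
    qed
  next
    fix Z assume "Z \<in> Ob D"
    with GF obtain X u where "X \<in> Ob B" "u \<in> hom D Z (on_ob (G \<circ>\<^sub>F F) X)" "iso_arr D u"
      by (rule weak_equivalence_ess_surjE) blast
    then show "\<exists>X \<in> Ob C. \<exists>u \<in> hom D Z (on_ob G X). iso_arr D u"
      using F.on_ob_in by auto
  qed
qed

text \<open>Naturality expresses \<open>\<alpha> Y \<cdot> f\<close> through the image of
  \<open>f\<close> under \<open>F\<close>, and the isomorphism \<open>\<alpha> Y\<close> can be
  cancelled.\<close>

lemma faithful_if_retraction:
  assumes H: "cat_functor D C H" and \<alpha>: "natural_isomorphism C C id_fun (H \<circ>\<^sub>F F) \<alpha>"
    and f: "f \<in> hom C X Y" and g: "g \<in> hom C X Y" and eq: "on_arr F f = on_arr F g"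
  shows "f = g"
proof -
  interpret \<alpha>: natural_isomorphism C C id_fun "H \<circ>\<^sub>F F" \<alpha> by fact
  have Y: "Y \<in> Ob C" using \<alpha>.F.source.hom_Ob[OF f] by auto
  have "\<alpha> Y \<cdot>\<^bsub>C\<^esub> f = \<alpha> Y \<cdot>\<^bsub>C\<^esub> g"
    using \<alpha>.naturality[OF f] \<alpha>.naturality[OF g] eq by simp
  then show ?thesis
    using \<alpha>.F.source.iso_left_cancel[OF \<alpha>.component_iso[OF Y] \<alpha>.component_in[OF Y]] f g by simp
qed

lemma weak_equivalence_if_equivalence:
  assumes "equivalence C D F"
  shows "weak_equivalence C D F"
proof -
  obtain H \<alpha> \<beta>' where F: "cat_functor C D F" and H: "cat_functor D C H"
      and \<alpha>: "natural_isomorphism C C id_fun (H \<circ>\<^sub>F F) \<alpha>"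
      and \<beta>': "natural_isomorphism D D (F \<circ>\<^sub>F H) id_fun \<beta>'"
    using assms by (auto simp: equivalence_def)
  \<comment> \<open>In this direction the isomorphism serves twice: it makes \<open>H\<close>
    faithful by \<open>faithful_if_retraction\<close>, and its component at \<open>Z\<close> leads
    from \<open>Z\<close> to an object in the image of \<open>F\<close>.\<close>
  obtain \<beta> where \<beta>: "natural_isomorphism D D id_fun (F \<circ>\<^sub>F H) \<beta>"
    using \<beta>' by (rule natural_isomorphism_inverse)
  interpret F: cat_functor C D F by fact
  interpret H: cat_functor D C H by fact
  interpret \<alpha>: natural_isomorphism C C id_fun "H \<circ>\<^sub>F F" \<alpha> by fact
  interpret \<beta>: natural_isomorphism D D id_fun "F \<circ>\<^sub>F H" \<beta> by fact
  show ?thesis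
    unfolding weak_equivalence_def
  proof (intro conjI ballI F)
    fix X Y assume X: "X \<in> Ob C" and Y: "Y \<in> Ob C"
    show "bij_betw (on_arr F) (hom C X Y) (hom D (on_ob F X) (on_ob F Y))"
      unfolding bij_betw_def
    proof (intro conjI inj_onI subset_antisym subsetI)
      fix f g assume "f \<in> hom C X Y" "g \<in> hom C X Y" "on_arr F f = on_arr F g"
      then show "f = g" by (rule faithful_if_retraction[OF H \<alpha>])
    next
      fix k assume "k \<in> on_arr F ` hom C X Y"
      then show "k \<in> hom D (on_ob F X) (on_ob F Y)" using F.on_arr_in by auto
    next
      fix k assume k: "k \<in> hom D (on_ob F X) (on_ob F Y)"
      have \<alpha>X: "\<alpha> X \<in> hom C X (on_ob H (on_ob F X))" and \<alpha>Y: "\<alpha> Y \<in> hom C Y (on_ob H (on_ob F Y))"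
        using \<alpha>.component_in X Y by auto
      obtain a where a: "a \<in> hom C (on_ob H (on_ob F Y)) Y" "\<alpha> Y \<cdot>\<^bsub>C\<^esub> a = Ident C (on_ob H (on_ob F Y))"
        using \<alpha>.component_iso[OF Y] \<alpha>Y by (rule F.source.iso_arrE) blast
      have Hk: "on_arr H k \<in> hom C (on_ob H (on_ob F X)) (on_ob H (on_ob F Y))"
        by (rule H.on_arr_in[OF k])
      \<comment> \<open>If \<open>k\<close> is the image of \<open>f\<close>, naturality of \<alpha>
        forces this formula, \<open>a\<close> being the inverse of \<open>\<alpha> Y\<close>.
        Conversely, for this \<open>f\<close> the arrows \<open>on_arr F f\<close> and
        \<open>k\<close> have the same image under \<open>H\<close>, and \<open>H\<close> is
        faithful.\<close>
      define f where "f = a \<cdot>\<^bsub>C\<^esub> on_arr H k \<cdot>\<^bsub>C\<^esub> \<alpha> X"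
      have H\<alpha>: "on_arr H k \<cdot>\<^bsub>C\<^esub> \<alpha> X \<in> hom C X (on_ob H (on_ob F Y))"
        by (rule F.source.Comp_in_hom[OF \<alpha>X Hk])
      have f: "f \<in> hom C X Y"
        unfolding f_def by (rule F.source.Comp_in_hom[OF H\<alpha> a(1)])
      have "on_arr H (on_arr F f) \<cdot>\<^bsub>C\<^esub> \<alpha> X = on_arr H k \<cdot>\<^bsub>C\<^esub> \<alpha> X"
        using \<alpha>.naturality[OF f] F.source.Comp_left_inverse[OF a(1) \<alpha>Y a(2) H\<alpha>] by (simp add: f_def)
      then have "on_arr H (on_arr F f) = on_arr H k"
        using F.source.iso_right_cancel[OF \<alpha>.component_iso[OF X] \<alpha>X]
          H.on_arr_in[OF F.on_arr_in[OF f]] Hk by blast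
      then have "on_arr F f = k"
        by (rule faithful_if_retraction[OF F \<beta> F.on_arr_in[OF f] k])
      with f show "k \<in> on_arr F ` hom C X Y" by blast
    qed
  next
    fix Z assume Z: "Z \<in> Ob D"
    then show "\<exists>X \<in> Ob C. \<exists>u \<in> hom D Z (on_ob F X). iso_arr D u"
      using \<beta>.component_in[OF Z] \<beta>.component_iso[OF Z] H.on_ob_in[OF Z] by auto
  qed
qed

section \<open>Adjoint equivalences\<close>

text \<open>Reversing arrows exchanges the two adjoints, unit with counit, and the two triangle
  identities. Statements about the left adjoint thus follow from those about the right one.\<close>

lemma adjunction_opposite:
  assumes "adjunction C D F G \<eta> \<epsilon>"
  shows "adjunction (opp D) (opp C) G F \<epsilon> \<eta>"
proof -
  interpret adjunction C D F G \<eta> \<epsilon> by fact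
  show ?thesis
    by (intro adjunction.intro F.opposite G.opposite adjunction_axioms.intro
        natural_transformation_opposite unit.natural_transformation_axioms
        counit.natural_transformation_axioms)
      (simp_all add: triangle_left triangle_right)
qed

section \<open>Invertibility of unit and counit\<close>

context adjunction
begin

text \<open>An arrow \<open>h\<close> out of \<open>on_ob F X\<close> is recovered from its
  transpose \<open>on_arr G h \<cdot> \<eta> X\<close> by applying \<open>F\<close> and composing
  with \<open>\<epsilon> Y\<close>: naturality of \<epsilon> and the left triangle identity give
  back \<open>h\<close>.\<close>

lemma hom_eqI:
  assumes "f \<in> hom D (on_ob F X) Y" "g \<in> hom D (on_ob F X) Y" "X \<in> Ob C"
    and "on_arr G f \<cdot>\<^bsub>C\<^esub> \<eta> X = on_arr G g \<cdot>\<^bsub>C\<^esub> \<eta> X"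
  shows "f = g"
proof -
  have key: "h = \<epsilon> Y \<cdot>\<^bsub>D\<^esub> on_arr F (on_arr G h \<cdot>\<^bsub>C\<^esub> \<eta> X)" if h: "h \<in> hom D (on_ob F X) Y" for h
  proof -
    have Y: "Y \<in> Ob D" using F.target.hom_Ob[OF h] by auto
    have \<eta>: "\<eta> X \<in> hom C X (on_ob G (on_ob F X))" using unit.component_in[OF assms(3)] by simp
    have \<epsilon>Y: "\<epsilon> Y \<in> hom D (on_ob F (on_ob G Y)) Y" using counit.component_in[OF Y] by simp
    have \<epsilon>X: "\<epsilon> (on_ob F X) \<in> hom D (on_ob F (on_ob G (on_ob F X))) (on_ob F X)"
      using counit.component_in[OF F.on_ob_in[OF assms(3)]] by simp
    note FG = F.on_arr_in[OF G.on_arr_in[OF h]]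
    have "\<epsilon> Y \<cdot>\<^bsub>D\<^esub> on_arr F (on_arr G h \<cdot>\<^bsub>C\<^esub> \<eta> X)
        = (\<epsilon> Y \<cdot>\<^bsub>D\<^esub> on_arr F (on_arr G h)) \<cdot>\<^bsub>D\<^esub> on_arr F (\<eta> X)"
      by (simp add: F.on_arr_Comp[OF \<eta> G.on_arr_in[OF h]]
          F.target.Comp_assoc[OF F.on_arr_in[OF \<eta>] FG \<epsilon>Y])
    also have "\<dots> = (h \<cdot>\<^bsub>D\<^esub> \<epsilon> (on_ob F X)) \<cdot>\<^bsub>D\<^esub> on_arr F (\<eta> X)"
      using counit.naturality[OF h] by simp
    also have "\<dots> = h"
      by (rule F.target.Comp_right_inverse[OF F.on_arr_in[OF \<eta>] \<epsilon>X triangle_left[OF assms(3)] h])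
    finally show ?thesis by simp
  qed
  show ?thesis using key[OF assms(1)] key[OF assms(2)] assms(4) by simp
qed

text \<open>The right triangle identity suggests that \<eta> at \<open>on_ob G Y\<close> is the
  image under \<open>G\<close> of an inverse of \<open>\<epsilon> Y\<close>. Fullness of
  \<open>G\<close> supplies that inverse, and essential surjectivity extends invertibility of \<eta>
  to all objects.\<close>

lemma unit_counit_iso_if_weak_equivalence_right:
  assumes G: "weak_equivalence D C G"
  shows "(\<forall>X \<in> Ob C. iso_arr C (\<eta> X)) \<and> (\<forall>Y \<in> Ob D. iso_arr D (\<epsilon> Y))"
proof -
  have both: "iso_arr D (\<epsilon> Y) \<and> iso_arr C (\<eta> (on_ob G Y))" if Y: "Y \<in> Ob D" for Y
  proof -
    let ?GY = "on_ob G Y" and ?FGY = "on_ob F (on_ob G Y)"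
    have Ob: "?GY \<in> Ob C" "?FGY \<in> Ob D" using Y by (simp_all add: G.on_ob_in F.on_ob_in)
    have \<epsilon>: "\<epsilon> Y \<in> hom D ?FGY Y" using counit.component_in[OF Y] by simp
    have \<eta>: "\<eta> ?GY \<in> hom C ?GY (on_ob G ?FGY)" using unit.component_in[OF Ob(1)] by simp
    have bij: "bij_betw (on_arr G) (hom D A B) (hom C (on_ob G A) (on_ob G B))"
      if "A \<in> Ob D" "B \<in> Ob D" for A B
      using G that by (simp add: weak_equivalence_def)
    obtain s where s: "s \<in> hom D Y ?FGY" "on_arr G s = \<eta> ?GY"
      using bij_betw_imp_surj_on[OF bij[OF Y Ob(2)]] \<eta> by (metis imageE)
    have \<epsilon>s: "\<epsilon> Y \<cdot>\<^bsub>D\<^esub> s = Ident D Y"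
    proof (rule inj_onD[OF bij_betw_imp_inj_on[OF bij[OF Y Y]]])
      show "on_arr G (\<epsilon> Y \<cdot>\<^bsub>D\<^esub> s) = on_arr G (Ident D Y)"
        by (simp add: G.on_arr_Comp[OF s(1) \<epsilon>] s(2) triangle_right Y G.on_arr_Ident)
    qed (use F.target.Comp_in_hom[OF s(1) \<epsilon>] F.target.Ident_in_hom[OF Y] in auto)
    \<comment> \<open>Both sides are compared through their transposes: that of
      \<open>s \<cdot> \<epsilon> Y\<close> is \<eta> at \<open>?GY\<close> followed by
      \<open>on_arr G (\<epsilon> Y)\<close> and again by \<eta> at \<open>?GY\<close>, which the
      right triangle identity collapses to \<eta> at \<open>?GY\<close>.\<close>
    have s\<epsilon>: "s \<cdot>\<^bsub>D\<^esub> \<epsilon> Y = Ident D ?FGY"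
    proof (rule hom_eqI[OF F.target.Comp_in_hom[OF \<epsilon> s(1)] F.target.Ident_in_hom[OF Ob(2)] Ob(1)])
      show "on_arr G (s \<cdot>\<^bsub>D\<^esub> \<epsilon> Y) \<cdot>\<^bsub>C\<^esub> \<eta> ?GY = on_arr G (Ident D ?FGY) \<cdot>\<^bsub>C\<^esub> \<eta> ?GY"
        using F.source.Comp_right_inverse[OF \<eta> G.on_arr_in[OF \<epsilon>] triangle_right[OF Y] \<eta>]
          F.source.Ident_Comp[OF \<eta>]
        by (simp add: G.on_arr_Comp[OF \<epsilon> s(1)] s(2) G.on_arr_Ident[OF Ob(2)])
    qed
    have "iso_arr D (\<epsilon> Y)" "iso_arr D s"
      using F.target.iso_arrI[OF \<epsilon> s(1) s\<epsilon> \<epsilon>s] F.target.iso_arrI[OF s(1) \<epsilon> \<epsilon>s s\<epsilon>] by auto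
    with G.iso_on_arr[OF _ s(1)] s(2) show ?thesis by simp
  qed
  moreover have "iso_arr C (\<eta> X)" if X: "X \<in> Ob C" for X
  proof -
    from G X obtain Y u where Y: "Y \<in> Ob D" and u: "u \<in> hom C X (on_ob G Y)" "iso_arr C u"
      by (rule weak_equivalence_ess_surjE) blast
    note FGu = G.on_arr_in[OF F.on_arr_in[OF u(1)]]
    have \<eta>: "\<eta> X \<in> hom C X (on_ob G (on_ob F X))"
        "\<eta> (on_ob G Y) \<in> hom C (on_ob G Y) (on_ob G (on_ob F (on_ob G Y)))"
      using unit.component_in X G.on_ob_in[OF Y] by auto
    \<comment> \<open>By naturality this composite equals
      \<open>on_arr G (on_arr F u) \<cdot> \<eta> X\<close>, whose left factor is invertible; hence
      so is \<open>\<eta> X\<close>.\<close>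
    have "iso_arr C (\<eta> (on_ob G Y) \<cdot>\<^bsub>C\<^esub> u)"
      using both[OF Y] F.source.iso_arr_Comp[OF u(2,1) _ \<eta>(2)] by blast
    then have "iso_arr C (on_arr G (on_arr F u) \<cdot>\<^bsub>C\<^esub> \<eta> X)"
      using unit.naturality[OF u(1)] by simp
    then show ?thesis
      by (rule F.source.iso_arr_right_factor[OF
            G.iso_on_arr[OF F.iso_on_arr[OF u(2,1)] F.on_arr_in[OF u(1)]] FGu \<eta>(1)])
  qed
  ultimately show ?thesis by blast
qed

lemma equivalences_if_unit_counit_iso:
  assumes "\<And>X. X \<in> Ob C \<Longrightarrow> iso_arr C (\<eta> X)" "\<And>Y. Y \<in> Ob D \<Longrightarrow> iso_arr D (\<epsilon> Y)"
  shows "equivalence C D F" "equivalence D C G"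
proof -
  have \<eta>: "natural_isomorphism C C id_fun (G \<circ>\<^sub>F F) \<eta>"
    and \<epsilon>: "natural_isomorphism D D (F \<circ>\<^sub>F G) id_fun \<epsilon>"
    using assms by unfold_locales auto
  then show "equivalence C D F"
    unfolding equivalence_def using F.cat_functor_axioms G.cat_functor_axioms by blast
  obtain \<eta>' \<epsilon>' where "natural_isomorphism C C (G \<circ>\<^sub>F F) id_fun \<eta>'"
      "natural_isomorphism D D id_fun (F \<circ>\<^sub>F G) \<epsilon>'"
    using \<eta> \<epsilon> natural_isomorphism_inverse by metis
  then show "equivalence D C G"
    unfolding equivalence_def using F.cat_functor_axioms G.cat_functor_axioms by blast
qed

lemma unit_counit_iso_if_weak_equivalence_left:
  assumes "weak_equivalence C D F"
  shows "(\<forall>X \<in> Ob C. iso_arr C (\<eta> X)) \<and> (\<forall>Y \<in> Ob D. iso_arr D (\<epsilon> Y))"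
  using adjunction.unit_counit_iso_if_weak_equivalence_right[OF
      adjunction_opposite[OF adjunction_axioms] weak_equivalence_opposite[OF assms]]
  by simp

text \<open>Each side holds exactly when unit and counit are both invertible.\<close>

lemma equivalence_left_iff_right: "equivalence C D F \<longleftrightarrow> equivalence D C G"
  using unit_counit_iso_if_weak_equivalence_left unit_counit_iso_if_weak_equivalence_right
    equivalences_if_unit_counit_iso weak_equivalence_if_equivalence by metis

lemma equivalence_right_iff_weak: "equivalence D C G \<longleftrightarrow> weak_equivalence D C G"
  using unit_counit_iso_if_weak_equivalence_right equivalences_if_unit_counit_iso(2)
    weak_equivalence_if_equivalence by metis

end

section \<open>Categories with duality\<close>

context category_with_duality
begin

lemma dual_opposite: "cat_functor C (opp C) V"
  using dual.opposite by simp

text \<open>Composition in \<open>opp C\<close> is reversed, so both triangle identities become the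
  single equation \<open>duality_triangle\<close>.\<close>

lemma self_adjunction: "adjunction C (opp C) V V j j"
proof (intro adjunction.intro adjunction_axioms.intro dual_opposite dual.cat_functor_axioms)
  show "natural_transformation C C id_fun (V \<circ>\<^sub>F V) j"
    by (rule double_dual.natural_transformation_axioms)
  then show "natural_transformation (opp C) (opp C) (V \<circ>\<^sub>F V) id_fun j"
    by (rule natural_transformation_opposite)
qed (simp_all add: duality_triangle)

text \<open>Unit and counit of \<open>self_adjunction\<close> are both \<open>j\<close>, and
  invertibility in \<open>opp C\<close> is invertibility in \<open>C\<close>. A strong duality
  therefore makes \<open>V\<close> an equivalence; conversely, a weak equivalence as right adjoint
  forces the unit \<open>j\<close> to be invertible.\<close>

lemma strong_iff_weak_equivalence:
  "strong_category_with_duality C V j \<longleftrightarrow> weak_equivalence (opp C) C V"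
proof
  assume "strong_category_with_duality C V j"
  then interpret strong_category_with_duality C V j .
  show "weak_equivalence (opp C) C V"
    using adjunction.equivalences_if_unit_counit_iso(2)[OF self_adjunction] component_iso
      weak_equivalence_if_equivalence by simp
next
  assume "weak_equivalence (opp C) C V"
  then have "\<forall>X \<in> Ob C. iso_arr C (j X)"
    using adjunction.unit_counit_iso_if_weak_equivalence_right[OF self_adjunction] by blast
  then show "strong_category_with_duality C V j"
    by unfold_locales auto
qed

end

section \<open>The duality obtained from an adjunction\<close>

locale duality_with_adjunction =
  category_with_duality C V j +
  adjunction C C F G \<eta> \<epsilon> +
  xi: natural_transformation "opp C" C "F \<circ>\<^sub>F V" "V \<circ>\<^sub>F G" \<xi>
  for C :: "('o, 'a) cat" and V j F G \<eta> \<epsilon> \<xi>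
begin

abbreviation "\<zeta> \<equiv> zeta C V j F G \<xi>"
abbreviation "\<omega> \<equiv> omega C V j F G \<eta> \<xi>"

lemma xi_V: "natural_transformation C C (F \<circ>\<^sub>F V \<circ>\<^sub>F V) (V \<circ>\<^sub>F G \<circ>\<^sub>F V) (\<lambda>X. \<xi> (on_ob V X))"
  using natural_transformation_whisker_right[OF xi.natural_transformation_axioms dual_opposite]
  by simp

lemma F_j: "natural_transformation C C F (F \<circ>\<^sub>F V \<circ>\<^sub>F V) (\<lambda>X. on_arr F (j X))"
  using natural_transformation_whisker_left[OF double_dual.natural_transformation_axioms
      F.cat_functor_axioms]
  by simp

text \<open>All three factors are whiskerings. The two that carry an outer \<open>V\<close> come
  from transformations first passed to the opposite categories, because \<open>V\<close> reverses
  their components.\<close>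

lemma zeta_natural: "natural_transformation (opp C) C (G \<circ>\<^sub>F V) (V \<circ>\<^sub>F F) \<zeta>"
proof -
  have "natural_transformation (opp C) C (G \<circ>\<^sub>F V) (V \<circ>\<^sub>F V \<circ>\<^sub>F G \<circ>\<^sub>F V)
      (\<lambda>X. j (on_ob G (on_ob V X)))"
    using natural_transformation_whisker_right[OF double_dual.natural_transformation_axioms
        cat_functor_comp[OF dual.cat_functor_axioms G.cat_functor_axioms]]
    by simp
  moreover have "natural_transformation (opp C) C (V \<circ>\<^sub>F V \<circ>\<^sub>F G \<circ>\<^sub>F V) (V \<circ>\<^sub>F F \<circ>\<^sub>F V \<circ>\<^sub>F V)
      (\<lambda>X. on_arr V (\<xi> (on_ob V X)))"
    by (rule natural_transformation_whisker_left[OF natural_transformation_opposite[OF xi_V]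
          dual.cat_functor_axioms])
  moreover have "natural_transformation (opp C) C (V \<circ>\<^sub>F F \<circ>\<^sub>F V \<circ>\<^sub>F V) (V \<circ>\<^sub>F F)
      (\<lambda>X. on_arr V (on_arr F (j X)))"
    by (rule natural_transformation_whisker_left[OF natural_transformation_opposite[OF F_j]
          dual.cat_functor_axioms])
  ultimately show ?thesis
    unfolding zeta_def by (intro natural_transformation_comp)
qed

lemma sharp_functor: "cat_functor (opp C) C (sharp V G)"
  unfolding sharp_def by (rule cat_functor_comp[OF dual.cat_functor_axioms G.cat_functor_axioms])

lemma omega_natural: "natural_transformation C C id_fun (sharp V G \<circ>\<^sub>F sharp V G) \<omega>"
proof -
  note whisker_G = natural_transformation_whisker_left[OF _ G.cat_functor_axioms]
  show ?thesis
    using natural_transformation_comp[OF natural_transformation_comp[OF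
          unit.natural_transformation_axioms whisker_G[OF F_j]] whisker_G[OF xi_V]]
    by (simp add: sharp_def omega_def[abs_def])
qed

text \<open>The transpose of \<open>\<omega> X\<close> under the adjunction; its dual is also the main factor of \<open>\<zeta> X\<close>.\<close>

definition "omega_transpose X = \<xi> (on_ob V X) \<cdot>\<^bsub>C\<^esub> on_arr F (j X)"

lemma V_Comp:
  "f \<in> hom C X Y \<Longrightarrow> g \<in> hom C Y Z \<Longrightarrow> on_arr V (g \<cdot>\<^bsub>C\<^esub> f) = on_arr V f \<cdot>\<^bsub>C\<^esub> on_arr V g"
  using dual.on_arr_Comp[of g Z Y f X] by simp

context
  fixes X assumes X: "X \<in> Ob C"
begin

lemma
  shows V_X: "on_ob V X \<in> Ob C"
    and G_V_X: "on_ob G (on_ob V X) \<in> Ob C"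
    and F_j_in: "on_arr F (j X) \<in> hom C (on_ob F X) (on_ob F (on_ob V (on_ob V X)))"
    and xi_in: "\<xi> (on_ob V X) \<in>
        hom C (on_ob F (on_ob V (on_ob V X))) (on_ob V (on_ob G (on_ob V X)))"
    and eta_in: "\<eta> X \<in> hom C X (on_ob G (on_ob F X))"
  using X dual.on_ob_in G.on_ob_in F.on_arr_in double_dual.component_in[OF X]
    xi.component_in[of "on_ob V X"] unit.component_in[OF X]
  by simp_all

lemma omega_transpose_in:
  "omega_transpose X \<in> hom C (on_ob F X) (on_ob V (on_ob G (on_ob V X)))"
  unfolding omega_transpose_def by (rule Comp_in_hom[OF F_j_in xi_in])

lemma omega_eq: "\<omega> X = on_arr G (omega_transpose X) \<cdot>\<^bsub>C\<^esub> \<eta> X"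
  unfolding omega_def omega_transpose_def G.on_arr_Comp[OF F_j_in xi_in]
  by (rule Comp_assoc[OF eta_in G.on_arr_in[OF F_j_in] G.on_arr_in[OF xi_in], symmetric])

lemma zeta_eq: "\<zeta> X = on_arr V (omega_transpose X) \<cdot>\<^bsub>C\<^esub> j (on_ob G (on_ob V X))"
proof -
  have "j (on_ob G (on_ob V X)) \<in> hom C (on_ob G (on_ob V X))
      (on_ob V (on_ob V (on_ob G (on_ob V X))))"
    using double_dual.component_in[OF G_V_X] by simp
  then show ?thesis
    unfolding zeta_def omega_transpose_def V_Comp[OF F_j_in xi_in]
    using dual.on_arr_in F_j_in xi_in by (intro Comp_assoc[symmetric]) auto
qed

end

text \<open>Writing \<open>m\<close> for \<open>omega_transpose X\<close> and \<open>B\<close> for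
  \<open>on_ob G (on_ob V X)\<close>, \<open>omega_eq\<close> splits the dual of
  \<open>\<omega> X\<close> into the duals of \<open>\<eta> X\<close> and \<open>on_arr G m\<close>.
  The latter moves past \<xi> as \<open>on_arr F (on_arr V m)\<close>, which combines with the image
  of \<open>j B\<close> under \<open>F\<close> to that of \<open>\<zeta> X\<close> by
  \<open>zeta_eq\<close>.\<close>

lemma omega_triangle_transpose:
  assumes X: "X \<in> Ob C"
  shows "on_arr V (\<omega> X) \<cdot>\<^bsub>C\<^esub> omega_transpose (on_ob G (on_ob V X))
      = on_arr V (\<eta> X) \<cdot>\<^bsub>C\<^esub> \<xi> (on_ob F X) \<cdot>\<^bsub>C\<^esub> on_arr F (\<zeta> X)"
proof -
  let ?B = "on_ob G (on_ob V X)" and ?m = "omega_transpose X"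
  note B = G_V_X[OF X] and m = omega_transpose_in[OF X]
  have FX: "on_ob F X \<in> Ob C" by (rule F.on_ob_in[OF X])
  have jB: "j ?B \<in> hom C ?B (on_ob V (on_ob V ?B))"
    using double_dual.component_in[OF B] by simp
  have Vm: "on_arr V ?m \<in> hom C (on_ob V (on_ob V ?B)) (on_ob V (on_ob F X))"
    using dual.on_arr_in m by simp
  have VGm: "on_arr V (on_arr G ?m) \<in>
      hom C (on_ob V (on_ob G (on_ob V ?B))) (on_ob V (on_ob G (on_ob F X)))"
    using dual.on_arr_in G.on_arr_in[OF m] by simp
  have V\<eta>: "on_arr V (\<eta> X) \<in> hom C (on_ob V (on_ob G (on_ob F X))) (on_ob V X)"
    using dual.on_arr_in eta_in[OF X] by simp
  have \<xi>FX: "\<xi> (on_ob F X) \<in> hom C (on_ob F (on_ob V (on_ob F X))) (on_ob V (on_ob G (on_ob F X)))"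
    using xi.component_in FX by simp
  note FjB = F_j_in[OF B] and \<xi>VB = xi_in[OF B] and FVm = F.on_arr_in[OF Vm]
  have "on_arr V (\<omega> X) \<cdot>\<^bsub>C\<^esub> omega_transpose ?B
      = on_arr V (\<eta> X) \<cdot>\<^bsub>C\<^esub> (on_arr V (on_arr G ?m) \<cdot>\<^bsub>C\<^esub> \<xi> (on_ob V ?B)) \<cdot>\<^bsub>C\<^esub> on_arr F (j ?B)"
    using Comp_assoc[OF omega_transpose_in[OF B] VGm V\<eta>] Comp_assoc[OF FjB \<xi>VB VGm]
    by (simp add: omega_eq[OF X] V_Comp[OF eta_in[OF X] G.on_arr_in[OF m]]
        omega_transpose_def[of ?B])
  \<comment> \<open>Naturality of \<xi> at \<open>?m\<close>, regarded as an arrow from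
    \<open>on_ob V ?B\<close> to \<open>on_ob F X\<close> in \<open>opp C\<close>.\<close>
  also have "on_arr V (on_arr G ?m) \<cdot>\<^bsub>C\<^esub> \<xi> (on_ob V ?B) = \<xi> (on_ob F X) \<cdot>\<^bsub>C\<^esub> on_arr F (on_arr V ?m)"
    using xi.naturality[of ?m "on_ob V ?B" "on_ob F X"] m by simp
  also have "(\<xi> (on_ob F X) \<cdot>\<^bsub>C\<^esub> on_arr F (on_arr V ?m)) \<cdot>\<^bsub>C\<^esub> on_arr F (j ?B)
      = \<xi> (on_ob F X) \<cdot>\<^bsub>C\<^esub> on_arr F (\<zeta> X)"
    by (simp add: Comp_assoc[OF FjB FVm \<xi>FX] F.on_arr_Comp[OF jB Vm] zeta_eq[OF X])
  finally show ?thesis .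
qed

text \<open>The composite in the new triangle identity is the transpose of
  \<open>on_arr V (\<omega> X) \<cdot> omega_transpose B\<close> with \<open>B\<close> as above. The
  assumption turns that arrow into \<epsilon> at \<open>on_ob V X\<close>, whose transpose is an
  identity by the right triangle identity.\<close>

lemma sharp_duality:
  assumes "\<forall>X \<in> Ob C. on_arr V (\<eta> X) \<cdot>\<^bsub>C\<^esub> \<xi> (on_ob F X) \<cdot>\<^bsub>C\<^esub> on_arr F (\<zeta> X) = \<epsilon> (on_ob V X)"
  shows "category_with_duality C (sharp V G) \<omega>"
proof (intro category_with_duality.intro category_with_duality_axioms.intro category_axioms
    sharp_functor omega_natural)
  fix X assume X: "X \<in> Ob C"
  let ?B = "on_ob G (on_ob V X)"
  note B = G_V_X[OF X]
  interpret omega: natural_transformation C C id_fun "sharp V G \<circ>\<^sub>F sharp V G" \<omega>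
    by (rule omega_natural)
  have V\<omega>: "on_arr V (\<omega> X) \<in> hom C (on_ob V (on_ob G (on_ob V ?B))) (on_ob V X)"
    using dual.on_arr_in omega.component_in[OF X] by (simp add: sharp_def)
  note m = omega_transpose_in[OF B]
  have "on_arr G (on_arr V (\<omega> X)) \<cdot>\<^bsub>C\<^esub> \<omega> ?B
      = on_arr G (on_arr V (\<omega> X) \<cdot>\<^bsub>C\<^esub> omega_transpose ?B) \<cdot>\<^bsub>C\<^esub> \<eta> ?B"
    using Comp_assoc[OF eta_in[OF B] G.on_arr_in[OF m] G.on_arr_in[OF V\<omega>]]
    by (simp add: omega_eq[OF B] G.on_arr_Comp[OF m V\<omega>])
  also have "\<dots> = on_arr G (\<epsilon> (on_ob V X)) \<cdot>\<^bsub>C\<^esub> \<eta> ?B"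
    using omega_triangle_transpose[OF X] assms X by simp
  also have "\<dots> = Ident C ?B"
    by (rule triangle_right[OF V_X[OF X]])
  finally show "on_arr (sharp V G) (\<omega> X) \<cdot>\<^bsub>C\<^esub> \<omega> (on_ob (sharp V G) X) = Ident C (on_ob (sharp V G) X)"
    by (simp add: sharp_def)
qed

text \<open>Both properties are translated into \<open>weak_equivalence\<close>. Since
  \<open>V\<close> is one, composing with it leads from \<open>G\<close> to
  \<open>sharp V G\<close>, and cancelling it leads back.\<close>

lemma equivalence_iff_sharp_strong:
  assumes sharp: "category_with_duality C (sharp V G) \<omega>"
    and strong: "strong_category_with_duality C V j"
  shows "equivalence C C G \<longleftrightarrow> strong_category_with_duality C (sharp V G) \<omega>"
proof -
  have V: "weak_equivalence (opp C) C V"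
    using strong strong_iff_weak_equivalence by simp
  have "weak_equivalence C C G \<longleftrightarrow> weak_equivalence (opp C) C (sharp V G)"
    unfolding sharp_def
    using weak_equivalence_comp[OF V] weak_equivalence_left_factor[OF V G.cat_functor_axioms] by blast
  then show ?thesis
    using equivalence_right_iff_weak category_with_duality.strong_iff_weak_equivalence[OF sharp]
    by simp
qed

end

theorem lemma2p15:
  fixes C :: "('o, 'a) cat"
    and V F G :: "('o, 'a, 'o, 'a) fun_data"
    and j \<eta> \<epsilon> \<xi> :: "'o \<Rightarrow> 'a"
  assumes "category_with_duality C V j"
    and "adjunction C C F G \<eta> \<epsilon>"
    and "natural_transformation (opp C) C (F \<circ>\<^sub>F V) (V \<circ>\<^sub>F G) \<xi>"
  shows
    "natural_transformation (opp C) C (G \<circ>\<^sub>F V) (V \<circ>\<^sub>F F) (zeta C V j F G \<xi>) \<and>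
     cat_functor (opp C) C (sharp V G) \<and>
     natural_transformation C C id_fun (sharp V G \<circ>\<^sub>F sharp V G) (omega C V j F G \<eta> \<xi>) \<and>
     ((\<forall>X \<in> Ob C.
         on_arr V (\<eta> X) \<cdot>\<^bsub>C\<^esub> \<xi> (on_ob F X) \<cdot>\<^bsub>C\<^esub> on_arr F (zeta C V j F G \<xi> X) = \<epsilon> (on_ob V X)) \<longrightarrow>
       category_with_duality C (sharp V G) (omega C V j F G \<eta> \<xi>) \<and>
       (strong_category_with_duality C V j \<longrightarrow>
         (equivalence C C F \<longleftrightarrow> equivalence C C G) \<and>
         (equivalence C C G \<longleftrightarrow>
            strong_category_with_duality C (sharp V G) (omega C V j F G \<eta> \<xi>))))"
proof -
  interpret duality_with_adjunction C V j F G \<eta> \<epsilon> \<xi>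
    using assms by (intro duality_with_adjunction.intro)
  show ?thesis
    using zeta_natural sharp_functor omega_natural sharp_duality equivalence_left_iff_right
      equivalence_iff_sharp_strong by blast
qed

end
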